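(* Assume the $P$-ideal dichotomy $\mathsf{PID}$. Then $\mathsf{CP}$ holds, i.e. $\mathsf{CP}(\kappa,\omega)$ holds for every regular cardinal $\kappa>2^{\aleph_0}$.
   Context: For an uncountable set $Z$, a family $\mathcal I\subseteq[Z]^{\leq\omega}$ (countable subsets of $Z$) is a $P$-ideal if it is an ideal and for every countable $\{X_n:n<\omega\}\subseteq\mathcal I$ there is $X\in\mathcal I$ with $X_n\subseteq^* X$ (inclusion modulo finite) for all $n$. $\mathsf{PID}$ asserts: for every uncountable $Z$ and every $P$-ideal $\mathcal I\subseteq[Z]^{\leq\omega}$, either (a) there is an uncountable $Y\subseteq Z$ with $[Y]^{\leq\omega}\subseteq\mathcal I$, or (b) $Z=\bigcup_{n<\omega}A_n$ where each $A_n$ is orthogonal to $\mathcal I$, i.e. $X\cap Y$ is finite for all countably infinite $X\subseteq A_n$ and all $Y\in\mathcal I$. For regular cardinals $\lambda<\kappa$, a $\lambda$-covering matrix for $\kappa$ is a family $\mathcal D=(K(\alpha,\beta):\alpha<\lambda,\ \beta<\kappa)$ of subsets of $\kappa$ such that: (i) $\beta\subseteq\bigcup_{\alpha<\lambda}K(\alpha,\beta)$ for all $\beta$; (ii) $|K(\alpha,\beta)|<\kappa$; (iii) $K(\alpha,\beta)\subseteq K(\eta,\beta)$ whenever $\alpha<\eta<\lambda$; (iv) for all $\gamma<\beta<\kappa$ and $\alpha<\lambda$ there is $\eta<\lambda$ with $K(\alpha,\gamma)\subseteq K(\eta,\beta)$; (v) for every $X\subseteq\kappa$ with $|X|\leq\lambda$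 there is $\gamma_X<\kappa$ such that for all $\beta<\kappa$ and $\eta<\lambda$ there is $\alpha<\lambda$ with $K(\eta,\beta)\cap X\subseteq K(\alpha,\gamma_X)$. $[A]^\lambda$ is the family of subsets of $A$ of size $\lambda$; it is covered by $\mathcal D$ if each of its members is contained in some $K(\alpha,\beta)$. $\mathsf{CP}(\kappa,\lambda)$: for every $\lambda$-covering matrix $\mathcal D$ for $\kappa$ there is an unbounded $A\subseteq\kappa$ with $[A]^\lambda$ covered by $\mathcal D$. *)

theory Defs
  imports Main "HOL-Library.Countable_Set"
begin

unbundle cardinal_syntax

text \<open>
  Cardinals are represented as in the library, by a well-order \<open>k\<close> with \<open>Card_order k\<close>:
  the ordinals below \<open>k\<close> are the elements of \<open>Field k\<close>, and an ordinal \<open>b\<close> below \<open>k\<close>,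
  viewed as a set, is \<open>underS k b\<close>.  The cardinal \<open>\<omega>\<close> is \<open>natLeq\<close>.
\<close>

definition P_ideal :: "'a set \<Rightarrow> 'a set set \<Rightarrow> bool" where
  "P_ideal Z I \<longleftrightarrow>
     (\<forall>X\<in>I. X \<subseteq> Z \<and> countable X) \<and>
     {} \<in> I \<and>
     (\<forall>X\<in>I. \<forall>Y. Y \<subseteq> X \<longrightarrow> Y \<in> I) \<and>
     (\<forall>X\<in>I. \<forall>Y\<in>I. X \<union> Y \<in> I) \<and>
     (\<forall>S :: nat \<Rightarrow> 'a set. (\<forall>n. S n \<in> I) \<longrightarrow> (\<exists>X\<in>I. \<forall>n. finite (S n - X)))"

definition orthogonal :: "'a set \<Rightarrow> 'a set set \<Rightarrow> bool" where
  "orthogonal A I \<longleftrightarrow>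
     (\<forall>X Y. X \<subseteq> A \<and> countable X \<and> infinite X \<and> Y \<in> I \<longrightarrow> finite (X \<inter> Y))"

text \<open>
  HOL cannot quantify over types inside a formula, so the dichotomy is stated for all
  uncountable sets over a given type.
\<close>

definition P_ideal_dichotomy :: "'a itself \<Rightarrow> bool" where
  "P_ideal_dichotomy _ \<longleftrightarrow>
     (\<forall>(Z :: 'a set) I. uncountable Z \<and> P_ideal Z I \<longrightarrow>
        (\<exists>Y\<subseteq>Z. uncountable Y \<and> (\<forall>X\<subseteq>Y. countable X \<longrightarrow> X \<in> I)) \<or>
        (\<exists>A :: nat \<Rightarrow> 'a set. Z = (\<Union>n. A n) \<and> (\<forall>n. orthogonal (A n) I)))"

definition regular_cardinal :: "'a rel \<Rightarrow> bool" where
  "regular_cardinal k \<longleftrightarrow> Card_order k \<and> cinfinite k \<and> regularCard k"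

definition covering_matrix :: "'b rel \<Rightarrow> 'a rel \<Rightarrow> ('b \<Rightarrow> 'a \<Rightarrow> 'a set) \<Rightarrow> bool" where
  "covering_matrix l k K \<longleftrightarrow>
     (\<forall>a\<in>Field l. \<forall>b\<in>Field k. K a b \<subseteq> Field k) \<and>
     (\<forall>b\<in>Field k. underS k b \<subseteq> (\<Union>a\<in>Field l. K a b)) \<and>
     (\<forall>a\<in>Field l. \<forall>b\<in>Field k. |K a b| <o k) \<and>
     (\<forall>b\<in>Field k. \<forall>e\<in>Field l. \<forall>a\<in>underS l e. K a b \<subseteq> K e b) \<and>
     (\<forall>b\<in>Field k. \<forall>c\<in>underS k b. \<forall>a\<in>Field l. \<exists>e\<in>Field l. K a c \<subseteq> K e b) \<and>
     (\<forall>X\<subseteq>Field k. |X| \<le>o l \<longrightarrow>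
        (\<exists>g\<in>Field k. \<forall>b\<in>Field k. \<forall>e\<in>Field l. \<exists>a\<in>Field l. K e b \<inter> X \<subseteq> K a g))"

definition covered :: "'b rel \<Rightarrow> 'a rel \<Rightarrow> ('b \<Rightarrow> 'a \<Rightarrow> 'a set) \<Rightarrow> 'a set set \<Rightarrow> bool" where
  "covered l k K F \<longleftrightarrow> (\<forall>X\<in>F. \<exists>a\<in>Field l. \<exists>b\<in>Field k. X \<subseteq> K a b)"

text \<open>The arguments of \<open>CP\<close> are meant to be regular cardinals with \<open>l <o k\<close>.\<close>

definition CP :: "'a rel \<Rightarrow> 'b rel \<Rightarrow> bool" where
  "CP k l \<longleftrightarrow>
     (\<forall>K. covering_matrix l k K \<longrightarrow>
        (\<exists>A\<subseteq>Field k. cofinal A k \<and> covered l k K {X. X \<subseteq> A \<and> |X| =o l}))"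

end

theory Submission
  imports Defs
begin

text \<open>
  Let \<open>K\<close> be an \<open>\<omega>\<close>-covering matrix and let \<open>I\<close> consist of the countable sets that meet every
  \<open>K(n, \<beta>)\<close> in a finite set.  Condition (v), applied to the union of countably many members
  \<open>X\<^sub>n\<close> of \<open>I\<close>, reduces their intersections with the matrix to a single column \<open>\<gamma>\<close>, and
  \<open>\<Union>n. X\<^sub>n - K(n, \<gamma>)\<close> shows that \<open>I\<close> is a \<open>P\<close>-ideal.  An uncountable set with all its
  countable subsets in \<open>I\<close> cannot exist: an uncountable bounded part of it lies in the union of
  a single column, hence has infinite intersection with one \<open>K(n, \<beta>)\<close>.  So the dichotomy
  splits \<open>\<kappa>\<close> into countably many sets orthogonal to \<open>I\<close>, one of which, \<open>A\<close>, is unbounded.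
  If a countable \<open>X \<subseteq> A\<close> were not covered, choosing points of \<open>X\<close> outside
  \<open>K(0, \<gamma>), K(1, \<gamma>), \<dots>\<close> for a suitable column \<open>\<gamma>\<close> would give an infinite subset of \<open>A\<close>
  that belongs to \<open>I\<close>.
\<close>

lemma countable_iff_card_of_ordLeq_natLeq: "countable A \<longleftrightarrow> |A| \<le>o natLeq"
proof -
  have "countable A \<longleftrightarrow> |A| \<le>o |UNIV :: nat set|"
    unfolding countable_def card_of_ordLeq[symmetric] by simp
  also have "\<dots> \<longleftrightarrow> |A| \<le>o natLeq"
    using card_of_nat ordIso_symmetric ordLeq_ordIso_trans by blast
  finally show ?thesis .
qed

lemma regular_cardinal_bounded:
  assumes k: "regular_cardinal k" and S: "S \<subseteq> Field k" "|S| <o k"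
  obtains b where "b \<in> Field k" "S \<subseteq> underS k b"
proof -
  have wo: "wo_rel k"
    using k Card_order_wo_rel unfolding regular_cardinal_def by blast
  have "\<not> cofinal S k"
    using k S not_ordLess_ordIso unfolding regular_cardinal_def regularCard_def by blast
  then obtain b where b: "b \<in> Field k" "\<And>x. x \<in> S \<Longrightarrow> b = x \<or> (b, x) \<notin> k"
    unfolding cofinal_def by blast
  \<comment> \<open>That \<open>S\<close> is not cofinal bounds it only weakly, since
    \<open>b\<close> itself may lie in \<open>S\<close>. An infinite cardinal has no last element,
    so a larger \<open>c\<close> turns this into a strict bound.\<close>
  obtain c where c: "c \<in> Field k" "b \<noteq> c" "(b, c) \<in> k"
    using k Cinfinite_limit[OF b(1)] unfolding regular_cardinal_def by auto
  have "S \<subseteq> underS k c"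
  proof
    fix x assume x: "x \<in> S"
    then have "x \<in> Field k" using S(1) by blast
    then have xb: "(x, b) \<in> k"
      using b(2)[OF x] b(1) wo_rel.TOTALS[OF wo] by blast
    then have "(x, c) \<in> k" using xb c(3) transD[OF wo_rel.TRANS[OF wo]] by blast
    moreover have "x \<noteq> c" using xb c(2,3) antisymD[OF wo_rel.ANTISYM[OF wo]] by blast
    ultimately show "x \<in> underS k c" by (simp add: underS_def)
  qed
  with c(1) show thesis by (rule that)
qed

text \<open>\<open>Y\<close> may well be unbounded, but a copy of \<aleph>_1 inside it has size
  below \<open>k\<close> and is therefore bounded by regularity.\<close>

lemma uncountable_bounded_subset:
  assumes k: "regular_cardinal k" "cardSuc natLeq <o k"
    and Y: "Y \<subseteq> Field k" "uncountable Y"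
  obtains b where "b \<in> Field k" "uncountable (Y \<inter> underS k b)"
proof -
  let ?F = "Field (cardSuc natLeq)"
  have card: "|?F| =o cardSuc natLeq"
    by (simp add: cardSuc_Card_order natLeq_Card_order card_of_Field_ordIso)
  have "natLeq <o |Y|"
    using Y(2)
    by (simp add: countable_iff_card_of_ordLeq_natLeq
        not_ordLeq_iff_ordLess[OF natLeq_Well_order card_of_Well_order])
  then have "cardSuc natLeq \<le>o |Y|"
    using cardSuc_least natLeq_Card_order card_of_Card_order by blast
  then have "|?F| \<le>o |Y|" using card ordIso_ordLeq_trans by blast
  then obtain f where f: "inj_on f ?F" "f ` ?F \<subseteq> Y"
    unfolding card_of_ordLeq[symmetric] by blast
  have "|f ` ?F| <o k"
    using card_of_image ordLeq_ordIso_trans[OF _ card] ordLeq_ordLess_trans[OF _ k(2)] by blast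
  moreover have "f ` ?F \<subseteq> Field k" using f(2) Y(1) by blast
  ultimately obtain b where b: "b \<in> Field k" "f ` ?F \<subseteq> underS k b"
    using regular_cardinal_bounded[OF k(1)] by blast
  have "uncountable ?F"
    using card cardSuc_greater[OF natLeq_Card_order] ordIso_symmetric ordLess_ordIso_trans
      not_ordLess_ordLeq countable_iff_card_of_ordLeq_natLeq by blast
  then have "uncountable (f ` ?F)" using f(1) countable_image_inj_on by blast
  moreover have "f ` ?F \<subseteq> Y \<inter> underS k b" using f(2) b(2) by (rule Int_greatest)
  ultimately have "uncountable (Y \<inter> underS k b)" using countable_subset by blast
  with b(1) show thesis by (rule that)
qed

text \<open>Otherwise each piece has a bound \<open>b n\<close>. These countably many bounds lie
  strictly below some \<open>c\<close>, and the piece containing \<open>c\<close> then exceeds its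
  own bound.\<close>

lemma cofinal_piece_of_countable_cover:
  assumes k: "regular_cardinal k" "natLeq <o k" and A: "Field k = (\<Union>n :: nat. A n)"
  obtains n where "cofinal (A n) k"
proof (rule ccontr)
  assume "\<not> thesis"
  then have "\<not> cofinal (A n) k" for n using that by blast
  then have "\<forall>n. \<exists>b\<in>Field k. \<forall>x\<in>A n. b = x \<or> (b, x) \<notin> k"
    unfolding cofinal_def by simp
  then obtain b where b: "\<And>n. b n \<in> Field k" "\<And>n x. x \<in> A n \<Longrightarrow> b n = x \<or> (b n, x) \<notin> k"
    by metis
  have "|range b| \<le>o natLeq"
    by (simp flip: countable_iff_card_of_ordLeq_natLeq)
  then have "|range b| <o k" using k(2) ordLeq_ordLess_trans by blast
  moreover have "range b \<subseteq> Field k" using b(1) by blast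
  ultimately obtain c where c: "c \<in> Field k" "range b \<subseteq> underS k c"
    using regular_cardinal_bounded[OF k(1)] by blast
  from c(1) A obtain n where "c \<in> A n" by blast
  moreover have "b n \<noteq> c" "(b n, c) \<in> k" using c(2) by (auto simp: underS_def)
  ultimately show False using b(2) by blast
qed

text \<open>This is the orthogonal of the family of matrix entries, cut down to countable
  sets.\<close>

definition finite_trace_ideal :: "'a rel \<Rightarrow> (nat \<Rightarrow> 'a \<Rightarrow> 'a set) \<Rightarrow> 'a set set" where
  "finite_trace_ideal k K =
     {X. X \<subseteq> Field k \<and> countable X \<and> (\<forall>n. \<forall>b\<in>Field k. finite (X \<inter> K n b))}"

text \<open>Since \<open>Field natLeq\<close> is all of \<open>nat\<close>, rows are indexed by
  plain numbers. The first four lemmas put conditions (i), (iii), (iv) and (v) into that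
  form.\<close>

locale omega_covering_matrix =
  fixes k :: "'a rel" and K :: "nat \<Rightarrow> 'a \<Rightarrow> 'a set"
  assumes covering: "covering_matrix natLeq k K"
begin

lemma column_covers: "b \<in> Field k \<Longrightarrow> underS k b \<subseteq> (\<Union>n. K n b)"
  using covering unfolding covering_matrix_def by (simp add: Field_natLeq)

lemma column_mono:
  assumes "b \<in> Field k" "m \<le> n"
  shows "K m b \<subseteq> K n b"
proof (cases "m = n")
  case False
  with assms show ?thesis
    using covering unfolding covering_matrix_def by (simp add: Field_natLeq natLeq_underS_less)
qed simp

lemma column_absorbs: "b \<in> Field k \<Longrightarrow> c \<in> underS k b \<Longrightarrow> \<exists>n. K m c \<subseteq> K n b"
  using covering unfolding covering_matrix_def by (simp add: Field_natLeq)

lemma countable_trace: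
  assumes "X \<subseteq> Field k" "countable X"
  shows "\<exists>g\<in>Field k. \<forall>b\<in>Field k. \<forall>m. \<exists>n. K m b \<inter> X \<subseteq> K n g"
proof -
  have "|X| \<le>o natLeq" using assms(2) by (simp add: countable_iff_card_of_ordLeq_natLeq)
  with assms(1) show ?thesis
    using covering unfolding covering_matrix_def by (simp add: Field_natLeq)
qed

lemma P_ideal_finite_trace_ideal: "P_ideal (Field k) (finite_trace_ideal k K)"
proof -
  let ?I = "finite_trace_ideal k K"
  have bounds: "\<forall>X\<in>?I. X \<subseteq> Field k \<and> countable X" and empty: "{} \<in> ?I"
    by (simp_all add: finite_trace_ideal_def)
  have down: "Y \<in> ?I" if X: "X \<in> ?I" and Y: "Y \<subseteq> X" for X Y
  proof -
    have "finite (Y \<inter> K n b)" if "b \<in> Field k" for n b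
      using X that Y unfolding finite_trace_ideal_def
      by (auto intro: finite_subset[of "Y \<inter> K n b" "X \<inter> K n b"])
    then show ?thesis
      using X Y countable_subset[OF Y] unfolding finite_trace_ideal_def by auto
  qed
  have union: "\<forall>X\<in>?I. \<forall>Y\<in>?I. X \<union> Y \<in> ?I"
    by (simp add: finite_trace_ideal_def Int_Un_distrib2)
  have pseudounion: "\<exists>X\<in>?I. \<forall>n. finite (S n - X)" if "\<forall>n. S n \<in> ?I" for S :: "nat \<Rightarrow> 'a set"
  proof -
    from that have S: "S n \<subseteq> Field k" "countable (S n)" "b \<in> Field k \<Longrightarrow> finite (S n \<inter> K m b)" for n m b
      by (auto simp: finite_trace_ideal_def)
    have U: "(\<Union>n. S n) \<subseteq> Field k" "countable (\<Union>n. S n)" using S(1,2) by auto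
    obtain g where g: "g \<in> Field k"
      and trace: "\<And>b m. b \<in> Field k \<Longrightarrow> \<exists>n. K m b \<inter> (\<Union>n. S n) \<subseteq> K n g"
      using countable_trace[OF U] by blast
    define X where "X = (\<Union>n. S n - K n g)"
    have fin: "finite (X \<inter> K m g)" for m
    proof (rule finite_subset)
      \<comment> \<open>A point that entered \<open>X\<close> from \<open>S n\<close> avoids
        \<open>K n g\<close>, hence all earlier entries of the column; so meeting
        \<open>K m g\<close> forces \<open>n < m\<close>.\<close>
      show "X \<inter> K m g \<subseteq> (\<Union>n<m. S n \<inter> K m g)"
      proof
        fix x assume "x \<in> X \<inter> K m g"
        then obtain n where n: "x \<in> S n" "x \<notin> K n g" "x \<in> K m g" unfolding X_def by blast
        then have "n < m" using column_mono[OF g, of m n] by (meson not_less subsetD)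
        with n show "x \<in> (\<Union>n<m. S n \<inter> K m g)" by blast
      qed
      show "finite (\<Union>n<m. S n \<inter> K m g)" using S(3) g by blast
    qed
    have sub: "X \<subseteq> (\<Union>n. S n)" unfolding X_def by blast
    have "finite (X \<inter> K m b)" if b: "b \<in> Field k" for m b
    proof -
      obtain n where "K m b \<inter> (\<Union>n. S n) \<subseteq> K n g" using trace[OF b] by blast
      then have "X \<inter> K m b \<subseteq> X \<inter> K n g" using sub by blast
      then show ?thesis using fin finite_subset by blast
    qed
    then have "X \<in> finite_trace_ideal k K"
      using order_trans[OF sub U(1)] countable_subset[OF sub U(2)]
      by (simp add: finite_trace_ideal_def)
    \<comment> \<open>Whatever \<open>X\<close> omits from \<open>S n\<close> lies in
      \<open>S n \<inter> K n g\<close>, which is finite.\<close>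
    moreover have "finite (S n - X)" for n
      by (rule finite_subset[OF _ S(3)[OF g, of n n]]) (auto simp: X_def)
    ultimately show ?thesis by blast
  qed
  show ?thesis
    unfolding P_ideal_def using bounds empty down union pseudounion by simp
qed

lemma no_uncountable_in_finite_trace_ideal:
  assumes k: "regular_cardinal k" "cardSuc natLeq <o k"
    and Y: "Y \<subseteq> Field k" "uncountable Y"
  obtains X where "X \<subseteq> Y" "countable X" "X \<notin> finite_trace_ideal k K"
proof -
  obtain b where b: "b \<in> Field k" "uncountable (Y \<inter> underS k b)"
    using uncountable_bounded_subset[OF assms] .
  have "Y \<inter> underS k b \<subseteq> (\<Union>n. Y \<inter> K n b)" using column_covers[OF b(1)] by blast
  then have "uncountable (\<Union>n. Y \<inter> K n b)" using b(2) countable_subset by blast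
  \<comment> \<open>A countable union of countable sets is countable, so some entry of the column
    meets \<open>Y\<close> in an uncountable set.\<close>
  then obtain n where "uncountable (Y \<inter> K n b)" by blast
  then have "infinite (Y \<inter> K n b)" using countable_finite by blast
  then obtain X where X: "X \<subseteq> Y \<inter> K n b" "countable X" "infinite X"
    using infinite_countable_subset' by blast
  then have "X \<inter> K n b = X" by blast
  with X(3) b(1) have "X \<notin> finite_trace_ideal k K"
    unfolding finite_trace_ideal_def by (metis (no_types, lifting) mem_Collect_eq)
  with X show thesis using that by blast
qed

lemma covered_if_orthogonal:
  assumes k: "regular_cardinal k" "natLeq <o k"
    and A: "A \<subseteq> Field k" "orthogonal A (finite_trace_ideal k K)"
    and X: "X \<subseteq> A" "countable X"
  shows "\<exists>n. \<exists>b\<in>Field k. X \<subseteq> K n b"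
proof (rule ccontr)
  assume uncovered: "\<not> ?thesis"
  have XF: "X \<subseteq> Field k" using X(1) A(1) by blast
  obtain g where g: "g \<in> Field k" "\<And>b m. b \<in> Field k \<Longrightarrow> \<exists>n. K m b \<inter> X \<subseteq> K n g"
    using countable_trace[OF XF X(2)] by blast
  \<comment> \<open>The column \<open>g\<close> controls traces on \<open>X\<close> but need not
    cover \<open>X\<close>. A column \<open>c\<close> above both \<open>g\<close> and
    \<open>X\<close> does both: it absorbs the entries of column \<open>g\<close>, and its union
    contains \<open>X\<close>.\<close>
  have "|insert g X| \<le>o natLeq"
    using X(2) by (simp flip: countable_iff_card_of_ordLeq_natLeq)
  then have "|insert g X| <o k" using k(2) ordLeq_ordLess_trans by blast
  moreover have "insert g X \<subseteq> Field k" using g(1) XF by blast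
  ultimately obtain c where c: "c \<in> Field k" "insert g X \<subseteq> underS k c"
    using regular_cardinal_bounded[OF k(1)] by blast
  have gc: "g \<in> underS k c" using c(2) by blast
  have trace: "\<exists>n. K m b \<inter> X \<subseteq> K n c" if b: "b \<in> Field k" for b m
  proof -
    obtain i where "K m b \<inter> X \<subseteq> K i g" using g(2)[OF b] by blast
    moreover obtain n where "K i g \<subseteq> K n c" using column_absorbs[OF c(1) gc] by blast
    ultimately have "K m b \<inter> X \<subseteq> K n c" by (rule order_trans)
    then show ?thesis by (rule exI)
  qed
  have "\<forall>n. \<exists>x\<in>X. x \<notin> K n c" using uncovered c(1) by blast
  then obtain x where x: "\<And>n. x n \<in> X" "\<And>n. x n \<notin> K n c" by metis
  have fin: "finite (range x \<inter> K m c)" for m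
  proof (rule finite_subset)
    have "n < m" if "x n \<in> K m c" for n
      using that x(2)[of n] column_mono[OF c(1), of m n] by (meson not_less subsetD)
    then show "range x \<inter> K m c \<subseteq> x ` {..<m}" by blast
  qed simp
  \<comment> \<open>With finite range, some value \<open>x i\<close> would recur at arbitrarily
    large indices. But it lies in some \<open>K m c\<close>, hence in every later entry, which those
    recurrences avoid.\<close>
  have inf: "infinite (range x)"
  proof
    assume "finite (range x)"
    then obtain i where "infinite {n. x n = x i}"
      using pigeonhole_infinite[of UNIV x] by auto
    then have "\<exists>n\<ge>m. x n = x i" for m by (auto simp: infinite_nat_iff_unbounded_le)
    moreover obtain m where "x i \<in> K m c"
      using column_covers[OF c(1)] c(2) x(1)[of i] by blast
    ultimately show False using x(2) column_mono[OF c(1)] by (metis subsetD)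
  qed
  have sub: "range x \<subseteq> X" using x(1) by blast
  have "range x \<in> finite_trace_ideal k K"
    unfolding finite_trace_ideal_def
  proof (intro CollectI conjI allI ballI)
    fix m b assume "b \<in> Field k"
    then obtain n where "K m b \<inter> X \<subseteq> K n c" using trace by blast
    then have "range x \<inter> K m b \<subseteq> range x \<inter> K n c" using sub by blast
    then show "finite (range x \<inter> K m b)" using fin finite_subset by blast
  qed (use sub XF in auto)
  moreover have "range x \<subseteq> A" using sub X(1) by blast
  \<comment> \<open>Orthogonality is applied with \<open>range x\<close> in both roles, as subset of
    \<open>A\<close> and as member of the ideal.\<close>
  ultimately have "finite (range x \<inter> range x)"
    using A(2) inf unfolding orthogonal_def by blast
  with inf show False by simp
qed

end

theorem mainTheorem2:
  assumes "P_ideal_dichotomy TYPE('a)"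
  shows "\<forall>\<kappa> :: 'a rel. regular_cardinal \<kappa> \<and> ctwo ^c natLeq <o \<kappa> \<longrightarrow> CP \<kappa> natLeq"
proof (intro allI impI)
  fix k :: "'a rel"
  assume "regular_cardinal k \<and> ctwo ^c natLeq <o k"
  then have k: "regular_cardinal k" "ctwo ^c natLeq <o k" by auto
  \<comment> \<open>The bound on the continuum enters in the form that \<aleph>_1 lies below
    \<open>k\<close>.\<close>
  have "cardSuc natLeq \<le>o ctwo ^c natLeq"
    using cardSuc_least natLeq_Card_order Card_order_cexp ordLess_ctwo_cexp by blast
  then have succ: "cardSuc natLeq <o k" using k(2) ordLeq_ordLess_trans by blast
  then have nat: "natLeq <o k"
    using cardSuc_greater natLeq_Card_order ordLess_transitive by blast
  have "natLeq <o |Field k|"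
    using nat k(1) card_of_Field_ordIso ordIso_symmetric ordLess_ordIso_trans
    unfolding regular_cardinal_def by blast
  then have unc: "uncountable (Field k)"
    using not_ordLess_ordLeq countable_iff_card_of_ordLeq_natLeq by blast
  show "CP k natLeq"
    unfolding CP_def
  proof (intro allI impI)
    fix K assume "covering_matrix natLeq k K"
    then interpret omega_covering_matrix k K by unfold_locales
    let ?I = "finite_trace_ideal k K"
    have "\<not> (\<exists>Y\<subseteq>Field k. uncountable Y \<and> (\<forall>X\<subseteq>Y. countable X \<longrightarrow> X \<in> ?I))"
      using no_uncountable_in_finite_trace_ideal[OF k(1) succ] by metis
    then obtain A :: "nat \<Rightarrow> 'a set"
      where A: "Field k = (\<Union>n. A n)" "\<And>n. orthogonal (A n) ?I"
      using assms unc P_ideal_finite_trace_ideal unfolding P_ideal_dichotomy_def by metis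
    obtain n where n: "cofinal (A n) k"
      using cofinal_piece_of_countable_cover[OF k(1) nat A(1)] .
    have sub: "A n \<subseteq> Field k" using A(1) by blast
    have "covered natLeq k K {X. X \<subseteq> A n \<and> |X| =o natLeq}"
      unfolding covered_def
      using covered_if_orthogonal[OF k(1) nat sub A(2)]
      by (auto simp: Field_natLeq countable_iff_card_of_ordLeq_natLeq dest: ordIso_imp_ordLeq)
    with n sub show "\<exists>A\<subseteq>Field k. cofinal A k \<and> covered natLeq k K {X. X \<subseteq> A \<and> |X| =o natLeq}"
      by blast
  qed
qed

end
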